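(* Let $\Omega$ be an open, strictly convex subset of $\mathbb{R}^2$ with smooth boundary, axially symmetric (i.e. $(x,y)\in\Omega$ implies $(-x,y),(x,-y)\in\Omega$), and satisfying $[-1,1]\times[-1,1]\subset\Omega\subset[-\tfrac43,\tfrac43]\times[-\tfrac43,\tfrac43]$. Let $u:\Omega\to\mathbb{R}$ be a convex solution of \[ \frac{\det D^2u}{(1+|Du|^2)^{3/2}}=\frac{2\pi}{\mathcal{A}(\Omega)}\ \text{in }\Omega,\qquad \lim_{x\to\partial\Omega}|Du|(x)=+\infty, \] where $\mathcal{A}(\Omega)$ is the area of $\Omega$. Then for every $\alpha\in(0,1/6)$, \[ u(1-6\alpha,-1)-u(0,0)\le 6\Big(1+\frac{1}{\alpha^2}\Big). \] *)

theory Defs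
  imports "HOL-Analysis.Analysis"
begin

text \<open>A function on the plane is smooth (C-infinity): there is a family of iterated partial
  derivatives \<open>D ds\<close>, indexed by lists of coordinate directions, with \<open>D [] = f\<close> and each
  \<open>D ds\<close> differentiable with partial derivatives \<open>D (i # ds)\<close>.\<close>
definition smooth_fn :: "(real^2 \<Rightarrow> real) \<Rightarrow> bool" where
  "smooth_fn f \<longleftrightarrow>
     (\<exists>D :: 2 list \<Rightarrow> real^2 \<Rightarrow> real. D [] = f \<and>
        (\<forall>ds x. (D ds has_derivative (\<lambda>h. \<Sum>i\<in>UNIV. h $ i * D (i # ds) x)) (at x)))"

definition smooth_boundary :: "(real^2) set \<Rightarrow> bool" where
  "smooth_boundary \<Omega> \<longleftrightarrow>
     (\<exists>\<rho>. smooth_fn \<rho> \<and> \<Omega> = {x. \<rho> x < 0} \<and>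
        (\<forall>x\<in>frontier \<Omega>. \<rho> x = 0 \<and> frechet_derivative \<rho> (at x) \<noteq> (\<lambda>h. 0)))"

definition strictly_convex_set :: "(real^2) set \<Rightarrow> bool" where
  "strictly_convex_set \<Omega> \<longleftrightarrow>
     convex \<Omega> \<and> (\<forall>x\<in>closure \<Omega>. \<forall>y\<in>closure \<Omega>. x \<noteq> y \<longrightarrow> open_segment x y \<subseteq> \<Omega>)"

definition axially_symmetric :: "(real^2) set \<Rightarrow> bool" where
  "axially_symmetric \<Omega> \<longleftrightarrow>
     (\<forall>p\<in>\<Omega>. vector [- (p $ 1), p $ 2] \<in> \<Omega> \<and> vector [p $ 1, - (p $ 2)] \<in> \<Omega>)"

end

theory Submission
  imports Defs
begin

text \<open>The area of \<open>\<Omega>\<close> is at most 64/9, so the left-hand side of the equation, here called the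
  curvature, is at least \<open>4/5\<close>. By the maximum principle a barrier \<open>w\<close> whose curvature is less than
  \<open>4/5\<close> cannot touch \<open>u\<close> from above, so \<open>u - w\<close> attains its maximum on the boundary or at a singularity of \<open>w\<close>. A rotational barrier with a conical tip at the
  origin bounds \<open>u - u 0\<close> on the horizontal axis inside the unit disc. From this,
  \<open>w x y = 75 / (r\<^sup>2 - x\<^sup>2)\<^sup>2 * (5/4 - sqrt (y + 1))\<close> on \<open>{-r<..<r} \<times> {-1..0}\<close> bounds \<open>u\<close> on the bottom
  side of the square: \<open>w\<close> blows up at the lateral sides, and its infinite slope at \<open>y = -1\<close> excludes a
  maximum of \<open>u - w\<close> there.\<close>

section \<open>One-variable second derivative test\<close>

text \<open>A positive \<open>k\<close> would make \<open>f'\<close> positive just to the right of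
  its zero at 0, and the mean value theorem would then give a value of \<open>f\<close> above
  \<open>f 0\<close>.\<close>

lemma second_derivative_at_local_max:
  fixes f f' :: "real \<Rightarrow> real"
  assumes "d > 0"
    and f: "\<And>t. \<bar>t\<bar> < d \<Longrightarrow> (f has_real_derivative f' t) (at t)"
    and f': "(f' has_real_derivative k) (at 0)"
    and max: "\<And>t. \<bar>t\<bar> < d \<Longrightarrow> f t \<le> f 0"
  shows "f' 0 = 0" and "k \<le> 0"
proof -
  show *: "f' 0 = 0"
    using DERIV_local_max[OF f[of 0] \<open>d > 0\<close>] \<open>d > 0\<close> max by simp
  show "k \<le> 0"
  proof (rule ccontr)
    assume "\<not> k \<le> 0"
    then obtain e where e: "e > 0" "\<And>h. 0 < h \<Longrightarrow> h < e \<Longrightarrow> f' 0 < f' (0 + h)"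
      using DERIV_pos_inc_right[OF f'] by auto
    define h where "h = min d e / 2"
    have h: "0 < h" "h < d" "h < e"
      using e \<open>d > 0\<close> by (auto simp: h_def)
    obtain z where z: "0 < z" "z < h" "f h - f 0 = (h - 0) * f' z"
      using MVT2[of 0 h f f'] f h by force
    have "f' z > 0"
      using e(2)[of z] z h * by simp
    then show False
      using z h max[of h] by (smt (verit) mult_pos_pos)
  qed
qed

section \<open>The Hessian of a convex function: symmetry, positivity, determinant\<close>

locale convex_C2 =
  fixes \<Omega> :: "(real^2) set" and u :: "real^2 \<Rightarrow> real"
    and Du :: "real^2 \<Rightarrow> real^2" and D2u :: "real^2 \<Rightarrow> real^2 \<Rightarrow> real^2"
  assumes open_\<Omega>: "open \<Omega>"
    and convex_u: "convex_on \<Omega> u"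
    and has_gradient: "\<And>x. x \<in> \<Omega> \<Longrightarrow> (u has_derivative (\<lambda>h. Du x \<bullet> h)) (at x)"
    and has_hessian: "\<And>x. x \<in> \<Omega> \<Longrightarrow> (Du has_derivative D2u x) (at x)"
    and hessian_continuous: "continuous_on \<Omega> (\<lambda>x. matrix (D2u x))"
begin

lemma linear_D2u: "x \<in> \<Omega> \<Longrightarrow> linear (D2u x)"
  using has_hessian has_derivative_linear by blast

lemma matrix_D2u: "x \<in> \<Omega> \<Longrightarrow> matrix (D2u x) *v v = D2u x v"
  using linear_D2u by (simp add: matrix_works linear_matrix_vector_mul_eq)

lemma directional_derivative:
  assumes "x + t *\<^sub>R v \<in> \<Omega>"
  shows "((\<lambda>t. u (x + t *\<^sub>R v)) has_real_derivative Du (x + t *\<^sub>R v) \<bullet> v) (at t)"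
proof -
  have "((\<lambda>t. u (x + t *\<^sub>R v)) has_derivative (\<lambda>h. Du (x + t *\<^sub>R v) \<bullet> (h *\<^sub>R v))) (at t)"
    by (rule has_derivative_compose[where f = "\<lambda>t. x + t *\<^sub>R v", OF _ has_gradient[OF assms]]) (auto intro!: derivative_eq_intros)
  then show ?thesis
    by (simp add: has_field_derivative_def mult_commute_abs)
qed

lemma directional_derivative2:
  assumes "x + t *\<^sub>R v \<in> \<Omega>"
  shows "((\<lambda>t. Du (x + t *\<^sub>R v) \<bullet> w) has_real_derivative D2u (x + t *\<^sub>R v) v \<bullet> w) (at t)"
proof -
  have "((\<lambda>t. Du (x + t *\<^sub>R v)) has_derivative (\<lambda>h. D2u (x + t *\<^sub>R v) (h *\<^sub>R v))) (at t)"
    by (rule has_derivative_compose[where f = "\<lambda>t. x + t *\<^sub>R v", OF _ has_hessian[OF assms]]) (auto intro!: derivative_eq_intros)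
  then have "((\<lambda>t. Du (x + t *\<^sub>R v) \<bullet> w) has_derivative (\<lambda>h. D2u (x + t *\<^sub>R v) (h *\<^sub>R v) \<bullet> w)) (at t)"
    by (rule has_derivative_inner_left)
  then show ?thesis
    by (simp add: has_field_derivative_def linear_cmul[OF linear_D2u[OF assms]] mult_commute_abs)
qed

text \<open>The mean value theorem is applied twice: first along \<open>v\<close> to the difference
  of \<open>u\<close> between two segments shifted by \<open>h *\<^sub>R w\<close>, then along
  \<open>w\<close> to the derivative so obtained. The left-hand side is symmetric in
  \<open>v\<close> and \<open>w\<close>, the right-hand side not visibly so; this is the source of
  the symmetry of the Hessian.\<close>

lemma second_difference:
  assumes ball: "ball x \<epsilon> \<subseteq> \<Omega>" and "h > 0" and h: "h * (norm v + norm w) < \<epsilon>"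
  shows "\<exists>s t. 0 < s \<and> s < h \<and> 0 < t \<and> t < h \<and>
    u (x + h *\<^sub>R v + h *\<^sub>R w) - u (x + h *\<^sub>R v) - u (x + h *\<^sub>R w) + u x
      = h\<^sup>2 * (D2u (x + s *\<^sub>R v + t *\<^sub>R w) w \<bullet> v)"
proof -
  have in_\<Omega>: "x + s *\<^sub>R v + t *\<^sub>R w \<in> \<Omega>" if "0 \<le> s" "s \<le> h" "0 \<le> t" "t \<le> h" for s t
  proof -
    have "norm (s *\<^sub>R v + t *\<^sub>R w) \<le> s * norm v + t * norm w"
      using norm_triangle_ineq[of "s *\<^sub>R v" "t *\<^sub>R w"] that by simp
    also have "\<dots> \<le> h * norm v + h * norm w"
      using that by (intro add_mono mult_right_mono) auto
    finally have "norm (s *\<^sub>R v + t *\<^sub>R w) < \<epsilon>"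
      using h by (simp add: algebra_simps)
    then show ?thesis
      using ball by (auto simp: dist_norm norm_minus_commute add.assoc subset_iff)
  qed
  define g where "g s = u ((x + h *\<^sub>R w) + s *\<^sub>R v) - u (x + s *\<^sub>R v)" for s
  define g' where "g' s = Du ((x + h *\<^sub>R w) + s *\<^sub>R v) \<bullet> v - Du (x + s *\<^sub>R v) \<bullet> v" for s
  have "(g has_real_derivative g' s) (at s)" if "0 \<le> s" "s \<le> h" for s
    unfolding g_def g'_def
    using in_\<Omega>[of s h] in_\<Omega>[of s 0] that \<open>h > 0\<close>
    by (intro DERIV_diff directional_derivative) (auto simp: algebra_simps)
  then obtain s where s: "0 < s" "s < h" "g h - g 0 = (h - 0) * g' s"
    using MVT2[of 0 h g g'] \<open>h > 0\<close> by force
  define k where "k t = Du ((x + s *\<^sub>R v) + t *\<^sub>R w) \<bullet> v" for t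
  define k' where "k' t = D2u ((x + s *\<^sub>R v) + t *\<^sub>R w) w \<bullet> v" for t
  have "(k has_real_derivative k' t) (at t)" if "0 \<le> t" "t \<le> h" for t
    unfolding k_def k'_def
    using in_\<Omega>[of s t] that s by (intro directional_derivative2) auto
  then obtain t where t: "0 < t" "t < h" "k h - k 0 = (h - 0) * k' t"
    using MVT2[of 0 h k k'] \<open>h > 0\<close> by force
  have "g' s = k h - k 0"
    by (simp add: g'_def k_def algebra_simps)
  then have "g h - g 0 = h\<^sup>2 * k' t"
    using s t by (simp add: power2_eq_square)
  then have "u (x + h *\<^sub>R v + h *\<^sub>R w) - u (x + h *\<^sub>R v) - u (x + h *\<^sub>R w) + u x = h\<^sup>2 * k' t"
    by (simp add: g_def algebra_simps)
  then show ?thesis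
    using s t unfolding k'_def by blast
qed

text \<open>Both orders of taking the mixed second difference give the same number, so two mixed
  derivatives at points close to \<open>x\<close> coincide. By continuity this is impossible if they
  differ at \<open>x\<close>.\<close>

lemma D2u_symmetric:
  assumes "x \<in> \<Omega>"
  shows "D2u x w \<bullet> v = D2u x v \<bullet> w"
proof (rule ccontr)
  assume neq: "D2u x w \<bullet> v \<noteq> D2u x v \<bullet> w"
  \<comment> \<open>Half the gap: no number is within \<open>e\<close> of both mixed derivatives at
    \<open>x\<close>.\<close>
  define e where "e = \<bar>D2u x w \<bullet> v - D2u x v \<bullet> w\<bar> / 2"
  have "e > 0"
    using neq by (simp add: e_def)
  have cont: "isCont (\<lambda>y. D2u y a \<bullet> b) x" for a b
  proof -
    have "continuous_on \<Omega> (\<lambda>y. (matrix (D2u y) *v a) \<bullet> b)"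
      unfolding matrix_vector_mult_def
      by (intro continuous_intros continuous_on_vec_lambda continuous_on_component hessian_continuous)
    then have "continuous_on \<Omega> (\<lambda>y. D2u y a \<bullet> b)"
      by (rule continuous_on_eq) (simp add: matrix_D2u)
    then show ?thesis
      using assms open_\<Omega> continuous_on_eq_continuous_at by blast
  qed
  obtain d1 where d1: "d1 > 0" "\<And>y. dist y x < d1 \<Longrightarrow> dist (D2u y w \<bullet> v) (D2u x w \<bullet> v) < e"
    using cont[of w v] \<open>e > 0\<close> unfolding continuous_at_eps_delta by blast
  obtain d2 where d2: "d2 > 0" "\<And>y. dist y x < d2 \<Longrightarrow> dist (D2u y v \<bullet> w) (D2u x v \<bullet> w) < e"
    using cont[of v w] \<open>e > 0\<close> unfolding continuous_at_eps_delta by blast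
  obtain d3 where d3: "d3 > 0" "ball x d3 \<subseteq> \<Omega>"
    using assms open_\<Omega> open_contains_ball by blast
  define d where "d = min d1 (min d2 d3)"
  define h where "h = d / (norm v + norm w + 1)"
  have d: "d > 0" "ball x d \<subseteq> \<Omega>"
    using d1 d2 d3 by (auto simp: d_def)
  have n: "norm v + norm w + 1 > 0"
    by (smt (verit) norm_ge_zero)
  have h: "h > 0" "h * (norm v + norm w) < d"
    using d n by (auto simp: h_def field_simps)
  \<comment> \<open>The condition on \<open>norm a + norm b\<close> covers both orders,
    \<open>(v, w)\<close> and \<open>(w, v)\<close>.\<close>
  have close: "norm (s *\<^sub>R a + t *\<^sub>R b) < d"
    if "0 < s" "s < h" "0 < t" "t < h" "norm a + norm b = norm v + norm w" for s t and a b :: "real^2"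
  proof -
    have "norm (s *\<^sub>R a + t *\<^sub>R b) \<le> s * norm a + t * norm b"
      using norm_triangle_ineq[of "s *\<^sub>R a" "t *\<^sub>R b"] that by simp
    also have "\<dots> \<le> h * norm a + h * norm b"
      using that by (intro add_mono mult_right_mono) auto
    also have "\<dots> = h * (norm v + norm w)"
      using that by (metis distrib_left)
    finally show ?thesis
      using h by simp
  qed
  obtain s t where st: "0 < s" "s < h" "0 < t" "t < h"
    "u (x + h *\<^sub>R v + h *\<^sub>R w) - u (x + h *\<^sub>R v) - u (x + h *\<^sub>R w) + u x
      = h\<^sup>2 * (D2u (x + s *\<^sub>R v + t *\<^sub>R w) w \<bullet> v)"
    using second_difference[OF d(2) h] by blast
  obtain s' t' where st': "0 < s'" "s' < h" "0 < t'" "t' < h"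
    "u (x + h *\<^sub>R w + h *\<^sub>R v) - u (x + h *\<^sub>R w) - u (x + h *\<^sub>R v) + u x
      = h\<^sup>2 * (D2u (x + s' *\<^sub>R w + t' *\<^sub>R v) v \<bullet> w)"
    using second_difference[OF d(2) h(1), of w v] h(2) by (auto simp: add.commute)
  have "h\<^sup>2 * (D2u (x + s *\<^sub>R v + t *\<^sub>R w) w \<bullet> v) = h\<^sup>2 * (D2u (x + s' *\<^sub>R w + t' *\<^sub>R v) v \<bullet> w)"
    using st(5) st'(5) by (simp add: algebra_simps)
  then have eq: "D2u (x + s *\<^sub>R v + t *\<^sub>R w) w \<bullet> v = D2u (x + s' *\<^sub>R w + t' *\<^sub>R v) v \<bullet> w"
    using h by simp
  have "dist (D2u (x + s *\<^sub>R v + t *\<^sub>R w) w \<bullet> v) (D2u x w \<bullet> v) < e"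
    using close[OF st(1-4), of v w] by (intro d1) (simp add: dist_norm add.assoc d_def)
  moreover have "dist (D2u (x + s' *\<^sub>R w + t' *\<^sub>R v) v \<bullet> w) (D2u x v \<bullet> w) < e"
    using close[OF st'(1-4), of w v] by (intro d2) (simp add: dist_norm add.assoc d_def)
  ultimately show False
    using eq unfolding e_def dist_real_def by argo
qed

text \<open>By midpoint convexity \<open>- u (x + t v) - u (x - t v)\<close> is largest at
  \<open>t = 0\<close>, and its second derivative there is \<open>-2\<close> times the quadratic
  form.\<close>

lemma D2u_nonneg:
  assumes "x \<in> \<Omega>"
  shows "D2u x v \<bullet> v \<ge> 0"
proof -
  obtain e where e: "e > 0" "ball x e \<subseteq> \<Omega>"
    using assms open_\<Omega> open_contains_ball by blast
  define d where "d = e / (norm v + 1)"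
  have "d > 0"
    using e by (auto simp: d_def intro!: divide_pos_pos add_nonneg_pos)
  have in_\<Omega>: "x + t *\<^sub>R v \<in> \<Omega>" if "\<bar>t\<bar> < d" for t
  proof -
    have "\<bar>t\<bar> * (norm v + 1) < e"
      using that by (simp add: d_def pos_less_divide_eq add_nonneg_pos)
    then have "\<bar>t\<bar> * norm v < e"
      by (smt (verit) abs_ge_zero mult_left_mono)
    then show ?thesis
      using e by (auto simp: dist_norm subset_iff)
  qed
  define f where "f t = - u (x + t *\<^sub>R v) - u (x + t *\<^sub>R (- v))" for t
  define f' where "f' t = - (Du (x + t *\<^sub>R v) \<bullet> v) - Du (x + t *\<^sub>R (- v)) \<bullet> (- v)" for t
  have "(f has_real_derivative f' t) (at t)" if "\<bar>t\<bar> < d" for t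
    unfolding f_def f'_def using in_\<Omega>[of t] in_\<Omega>[of "-t"] that
    by (intro DERIV_diff DERIV_minus directional_derivative) auto
  moreover have "(f' has_real_derivative - (D2u (x + 0 *\<^sub>R v) v \<bullet> v) - D2u (x + 0 *\<^sub>R (- v)) (- v) \<bullet> (- v)) (at 0)"
    unfolding f'_def using assms
    by (intro DERIV_diff DERIV_minus directional_derivative2) auto
  moreover have "f t \<le> f 0" if "\<bar>t\<bar> < d" for t
  proof -
    have "u ((1 - 1/2) *\<^sub>R (x + t *\<^sub>R v) + (1/2) *\<^sub>R (x + (-t) *\<^sub>R v))
        \<le> (1 - 1/2) * u (x + t *\<^sub>R v) + 1/2 * u (x + (-t) *\<^sub>R v)"
      using that by (intro convex_onD[OF convex_u] in_\<Omega>) auto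
    moreover have "(1 - 1/2) *\<^sub>R (x + t *\<^sub>R v) + (1/2) *\<^sub>R (x + (-t) *\<^sub>R v) = x"
      by (simp add: vec_eq_iff field_simps)
    ultimately show ?thesis
      by (simp add: f_def)
  qed
  ultimately have "- (D2u (x + 0 *\<^sub>R v) v \<bullet> v) - D2u (x + 0 *\<^sub>R (- v)) (- v) \<bullet> (- v) \<le> 0"
    by (rule second_derivative_at_local_max(2)[OF \<open>d > 0\<close>])
  then show ?thesis
    using linear_neg[OF linear_D2u[OF assms], of v] by simp
qed

text \<open>In the orthonormal basis formed by \<open>e\<close> and its rotation by a right angle,
  the determinant of the symmetric Hessian is the product of the diagonal entries minus the square
  of the off-diagonal one.\<close>

lemma det_D2u_le:
  assumes "x \<in> \<Omega>" and e: "(e$1)\<^sup>2 + (e$2)\<^sup>2 = 1"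
  shows "det (matrix (D2u x)) \<le> (D2u x e \<bullet> e) * (D2u x (vector [- (e$2), e$1]) \<bullet> vector [- (e$2), e$1])"
proof -
  define M where "M = matrix (D2u x)"
  have D: "D2u x v = M *v v" for v
    unfolding M_def by (simp add: matrix_D2u[OF assms(1)])
  have "M $ 1 $ 2 = M $ 2 $ 1"
    using D2u_symmetric[OF assms(1), of "axis 1 1" "axis 2 1"]
    by (simp add: M_def matrix_def inner_axis)
  then have *: "det M * ((e$1)\<^sup>2 + (e$2)\<^sup>2)\<^sup>2
      = (D2u x e \<bullet> e) * (D2u x (vector [- (e$2), e$1]) \<bullet> vector [- (e$2), e$1])
        - (D2u x e \<bullet> vector [- (e$2), e$1])\<^sup>2"
    unfolding D by (simp add: det_2 inner_vec_def sum_2 matrix_vector_mult_def power2_eq_square algebra_simps)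
  show ?thesis
    using * zero_le_power2[of "D2u x e \<bullet> vector [- (e$2), e$1]"] by (simp add: e M_def)
qed

end

section \<open>Comparison at a touching point\<close>

locale curvature_bound = convex_C2 +
  assumes curvature: "\<And>x. x \<in> \<Omega> \<Longrightarrow> 4/5 * (1 + (norm (Du x))\<^sup>2) powr (3/2) \<le> det (matrix (D2u x))"
begin

text \<open>If \<open>u - w\<close> has a local maximum at \<open>x\<close>, where \<open>\<phi>\<close> and \<open>\<psi>\<close> are the restrictions of \<open>w\<close> to two
  orthogonal lines through \<open>x\<close>, then \<open>w\<close> cannot be less curved than \<open>u\<close>.\<close>
lemma touching_from_above:
  assumes "x \<in> \<Omega>" and e: "(e$1)\<^sup>2 + (e$2)\<^sup>2 = 1" and "d > 0"
    and \<phi>: "\<And>t. \<bar>t\<bar> < d \<Longrightarrow> (\<phi> has_real_derivative \<phi>' t) (at t)"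
      "(\<phi>' has_real_derivative k) (at 0)"
      "\<And>t. \<bar>t\<bar> < d \<Longrightarrow> u (x + t *\<^sub>R e) - \<phi> t \<le> u x - \<phi> 0"
    and \<psi>: "\<And>t. \<bar>t\<bar> < d \<Longrightarrow> (\<psi> has_real_derivative \<psi>' t) (at t)"
      "(\<psi>' has_real_derivative l) (at 0)"
      "\<And>t. \<bar>t\<bar> < d \<Longrightarrow> u (x + t *\<^sub>R vector [- (e$2), e$1]) - \<psi> t \<le> u x - \<psi> 0"
  shows "4/5 * \<bar>\<phi>' 0\<bar> ^ 3 < k * l"
proof -
  obtain \<epsilon> where \<epsilon>: "\<epsilon> > 0" "ball x \<epsilon> \<subseteq> \<Omega>"
    using assms open_\<Omega> open_contains_ball by blast
  define d' where "d' = min d \<epsilon>"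
  have d': "d' > 0" "d' \<le> d" "d' \<le> \<epsilon>"
    using \<epsilon> \<open>d > 0\<close> by (auto simp: d'_def)
  \<comment> \<open>The second derivative test for \<open>u - \<eta>\<close> on the line through
    \<open>x\<close> in direction \<open>v\<close>, used for both orthogonal directions.\<close>
  have test: "Du x \<bullet> v = \<eta>' 0 \<and> D2u x v \<bullet> v \<le> m"
    if v: "norm v = 1" and 1: "\<And>t. \<bar>t\<bar> < d \<Longrightarrow> (\<eta> has_real_derivative \<eta>' t) (at t)"
      and 2: "(\<eta>' has_real_derivative m) (at 0)"
      and 3: "\<And>t. \<bar>t\<bar> < d \<Longrightarrow> u (x + t *\<^sub>R v) - \<eta> t \<le> u x - \<eta> 0" for v \<eta> \<eta>' m
  proof -
    have in_\<Omega>: "x + t *\<^sub>R v \<in> \<Omega>" if "\<bar>t\<bar> < d'" for t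
      using that \<epsilon> d' v by (auto simp: dist_norm subset_iff)
    have D: "((\<lambda>t. u (x + t *\<^sub>R v) - \<eta> t) has_real_derivative Du (x + t *\<^sub>R v) \<bullet> v - \<eta>' t) (at t)"
      if "\<bar>t\<bar> < d'" for t
      using that d' by (intro DERIV_diff directional_derivative 1 in_\<Omega>) auto
    have D2: "((\<lambda>t. Du (x + t *\<^sub>R v) \<bullet> v - \<eta>' t) has_real_derivative D2u (x + 0 *\<^sub>R v) v \<bullet> v - m) (at 0)"
      using d' by (intro DERIV_diff directional_derivative2 2 in_\<Omega>) auto
    have max: "u (x + t *\<^sub>R v) - \<eta> t \<le> u (x + 0 *\<^sub>R v) - \<eta> 0" if "\<bar>t\<bar> < d'" for t
      using 3[of t] that d' by simp
    show ?thesis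
      using second_derivative_at_local_max[OF d'(1) D D2 max] by simp
  qed
  let ?f = "vector [- (e$2), e$1] :: real^2"
  have norms: "norm e = 1" "norm ?f = 1"
    using e by (auto simp: norm_eq_1 inner_vec_def sum_2 power2_eq_square algebra_simps)
  have e_slope: "Du x \<bullet> e = \<phi>' 0" and "D2u x e \<bullet> e \<le> k"
    using test[OF norms(1) \<phi>] by auto
  moreover have "D2u x ?f \<bullet> ?f \<le> l"
    using test[OF norms(2) \<psi>] by auto
  \<comment> \<open>The two upper bounds may be multiplied because convexity makes the second
    derivatives of \<open>u\<close> nonnegative.\<close>
  ultimately have "(D2u x e \<bullet> e) * (D2u x ?f \<bullet> ?f) \<le> k * l"
    using D2u_nonneg[OF \<open>x \<in> \<Omega>\<close>] by (intro mult_mono) (auto intro: order_trans)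
  then have det: "det (matrix (D2u x)) \<le> k * l"
    using det_D2u_le[OF \<open>x \<in> \<Omega>\<close> e] by linarith
  \<comment> \<open>Only the slope along \<open>e\<close> is kept from the gradient. Dropping the 1
    in \<open>1 + (norm (Du x))\<^sup>2\<close> makes the final inequality strict, so a barrier with
    equality between the two sides is already contradictory.\<close>
  have "\<bar>\<phi>' 0\<bar> \<le> norm (Du x)"
    using Cauchy_Schwarz_ineq2[of "Du x" e] e_slope norms by simp
  then have "\<bar>\<phi>' 0\<bar>\<^sup>2 < 1 + (norm (Du x))\<^sup>2"
    by (smt (verit) abs_ge_zero power_mono)
  then have "(\<bar>\<phi>' 0\<bar>\<^sup>2) powr (3/2) < (1 + (norm (Du x))\<^sup>2) powr (3/2)"
    by (intro powr_less_mono2) auto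
  moreover have "(\<bar>\<phi>' 0\<bar>\<^sup>2) powr (3/2) = \<bar>\<phi>' 0\<bar> ^ 3"
  proof -
    have "(\<bar>\<phi>' 0\<bar>\<^sup>2) powr (3/2) = (\<bar>\<phi>' 0\<bar> powr 2) powr (3/2)"
      by simp
    also have "\<dots> = \<bar>\<phi>' 0\<bar> powr 3"
      unfolding powr_powr by simp
    finally show ?thesis
      by simp
  qed
  ultimately show ?thesis
    using curvature[OF \<open>x \<in> \<Omega>\<close>] det by linarith
qed

end

section \<open>Derivative rules and boundedness used with the barriers\<close>

lemma DERIV_const_divide:
  fixes g :: "real \<Rightarrow> real"
  assumes "(g has_real_derivative g') (at x)" "g x \<noteq> 0"
  shows "((\<lambda>t. c / g t) has_real_derivative - c * g' / (g x)\<^sup>2) (at x)"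
  using DERIV_divide[OF DERIV_const assms] by (simp add: power2_eq_square)

text \<open>Caratheodory's form of the derivative: continuity of \<open>q\<close> suffices. It gives
  the tangential second derivative of a rotational function without differentiating the factor in
  front of \<open>t\<close>.\<close>

lemma DERIV_mult_id_at_0:
  fixes q :: "real \<Rightarrow> real"
  assumes "isCont q 0"
  shows "((\<lambda>t. q t * t) has_real_derivative q 0) (at 0)"
  unfolding CARAT_DERIV using assms by auto

context convex_C2
begin

lemma continuous_on_u: "continuous_on \<Omega> u"
  using has_gradient has_derivative_continuous
  by (blast intro: continuous_at_imp_continuous_on)

lemma bounded_above_on_compact:
  assumes "compact K" "K \<subseteq> \<Omega>"
  obtains B where "\<And>x. x \<in> K \<Longrightarrow> u x \<le> B"
proof -
  have "bounded (u ` K)"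
    by (intro compact_imp_bounded compact_continuous_image continuous_on_subset[OF continuous_on_u] assms)
  then have "bdd_above (u ` K)"
    by (rule bounded_imp_bdd_above)
  then show ?thesis
    using that by (auto simp: bdd_above_def)
qed

end

section \<open>The rotational barrier in the unit disc\<close>

context curvature_bound
begin

text \<open>The profile \<open>W\<close> solves \<open>W'' * (W' / r) = 4/5 * W' ^ 3\<close>, where
  \<open>W''\<close> and \<open>W' / r\<close> are the radial and tangential second derivatives.
  Integrating gives \<open>1 / W' = c - 2/5 * r^2\<close>, and infinite slope at radius 1 forces
  \<open>c = 2/5\<close>.\<close>

lemma bound_in_unit_disc:
  assumes disc: "cball 0 1 \<subseteq> \<Omega>" and x: "norm x < 1"
  shows "u x - u 0 \<le> 5/4 * ln ((1 + norm x) / (1 - norm x))"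
proof (rule ccontr)
  define W :: "real \<Rightarrow> real" where "W r = 5/4 * (ln (1 + r) - ln (1 - r))" for r
  assume "\<not> ?thesis"
  then have gt: "u x - W (norm x) > u 0"
    using x add_pos_nonneg[of 1 "norm x"] by (simp add: W_def ln_div not_le field_simps)
  obtain B where B: "\<And>y. y \<in> cball 0 1 \<Longrightarrow> u y \<le> B"
    using bounded_above_on_compact[OF compact_cball disc] by blast
  \<comment> \<open>The first term of the minimum keeps \<open>x\<close> inside radius
    \<open>R\<close>; the second makes \<open>W R\<close> exceed \<open>B - u 0\<close>, so that the
    maximum of \<open>u - W\<close> is not on the outer circle.\<close>
  define R where "R = 1 - min ((1 - norm x) / 2) (exp (- (\<bar>B - u 0\<bar> + 1)))"
  have R: "norm x < R" "R < 1"
    using x by (auto simp: R_def min_def field_simps)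
  then have R0: "R > 0"
    using norm_ge_zero[of x] by linarith
  have "ln (1 - R) \<le> ln (exp (- (\<bar>B - u 0\<bar> + 1)))"
    using R by (subst ln_le_cancel_iff) (auto simp: R_def)
  moreover have "ln (1 + R) \<ge> 0"
    using R0 by simp
  ultimately have WR: "W R > B - u 0"
    by (simp add: W_def)
  have "continuous_on (cball 0 R) (\<lambda>y. u y - W (norm y))"
    unfolding W_def using R disc
    by (intro continuous_intros continuous_on_subset[OF continuous_on_u])
       (auto simp: subset_iff add_nonneg_eq_0_iff)
  then obtain z where z: "norm z \<le> R" and max: "\<And>y. norm y \<le> R \<Longrightarrow> u y - W (norm y) \<le> u z - W (norm z)"
    using continuous_attains_sup[OF compact_cball, of 0 R "\<lambda>y. u y - W (norm y)"] R0 by auto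
  have z_gt: "u z - W (norm z) > u 0"
    using max[of x] gt R by simp
  define r where "r = norm z"
  have r: "0 < r" "r < R"
  proof -
    \<comment> \<open>At the conical tip \<open>u - W\<close> equals \<open>u 0\<close>, which is
      less than its value at the maximum point.\<close>
    show "0 < r"
      using z_gt by (auto simp: r_def W_def)
    have "r \<noteq> R"
      using z_gt WR B[of z] R z by (auto simp: r_def)
    then show "r < R"
      using z by (simp add: r_def)
  qed
  define e where "e = z /\<^sub>R r"
  have ze: "z = r *\<^sub>R e"
    using r by (simp add: e_def)
  have sq: "(z$1)\<^sup>2 + (z$2)\<^sup>2 = r\<^sup>2"
    by (simp add: r_def power2_norm_eq_inner inner_vec_def sum_2 flip: power2_eq_square)
  have e1: "(e$1)\<^sup>2 + (e$2)\<^sup>2 = 1"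
    using sq r unfolding e_def by (simp add: power_mult_distrib field_simps)
  have radial: "norm (z + t *\<^sub>R e) = r + t" if "\<bar>t\<bar> < r" for t
  proof -
    have "norm e = 1"
      using e1 by (simp add: norm_eq_1 inner_vec_def sum_2 flip: power2_eq_square)
    then show ?thesis
      using that by (simp add: ze flip: scaleR_left.add)
  qed
  have tangential: "norm (z + t *\<^sub>R vector [- (e$2), e$1]) = sqrt (r\<^sup>2 + t\<^sup>2)" for t
  proof -
    have "(norm (z + t *\<^sub>R vector [- (e$2), e$1]))\<^sup>2 = (r\<^sup>2 + t\<^sup>2) * ((e$1)\<^sup>2 + (e$2)\<^sup>2)"
      unfolding ze power2_norm_eq_inner
      by (simp add: inner_vec_def sum_2 power2_eq_square algebra_simps)
    then show ?thesis
      by (simp add: e1 real_sqrt_unique)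
  qed
  define d where "d = min r (R - r)"
  have d: "d > 0" "d \<le> r" "d \<le> R - r"
    using r by (auto simp: d_def)
  have DW: "(W has_real_derivative 5/2 / (1 - s\<^sup>2)) (at s)" if "\<bar>s\<bar> < 1" for s
  proof -
    have "1 - s\<^sup>2 \<noteq> 0"
      using that by (simp add: abs_square_eq_1)
    then show ?thesis
      unfolding W_def using that
      by (auto intro!: derivative_eq_intros simp: field_simps power2_eq_square)
  qed
  have sqrt_le: "sqrt (r\<^sup>2 + t\<^sup>2) < R" if "\<bar>t\<bar> < d" for t
  proof -
    \<comment> \<open>Keeps the tangent segment inside the disc of radius \<open>R\<close>.\<close>
    have "sqrt (r\<^sup>2 + t\<^sup>2) \<le> r + \<bar>t\<bar>"
      using r by (intro real_le_lsqrt) (auto simp: power2_eq_square algebra_simps)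
    then show ?thesis
      using that d by linarith
  qed
  have "r\<^sup>2 < 1"
    using r R by (simp add: abs_square_less_1)
  \<comment> \<open>Touching would force this strict inequality; the two sides turn out to be equal,
    by the differential equation for \<open>W\<close>.\<close>
  have "4/5 * \<bar>5/2 / (1 - (r + 0)\<^sup>2)\<bar> ^ 3 < (5 * r / (1 - r\<^sup>2)\<^sup>2) * (5/2 / (1 - r\<^sup>2) / r)"
  proof (rule touching_from_above[where x = z and e = e and d = d and \<phi> = "\<lambda>t. W (r + t)"
      and \<phi>' = "\<lambda>t. 5/2 / (1 - (r + t)\<^sup>2)" and \<psi> = "\<lambda>t. W (sqrt (r\<^sup>2 + t\<^sup>2))"
      and \<psi>' = "\<lambda>t. 5/2 / (1 - (sqrt (r\<^sup>2 + t\<^sup>2))\<^sup>2) / sqrt (r\<^sup>2 + t\<^sup>2) * t"])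
    show "z \<in> \<Omega>"
      using disc z R by (auto simp: subset_iff)
    show "(e$1)\<^sup>2 + (e$2)\<^sup>2 = 1" "d > 0"
      by fact+
    show "((\<lambda>t. W (r + t)) has_real_derivative 5/2 / (1 - (r + t)\<^sup>2)) (at t)" if "\<bar>t\<bar> < d" for t
    proof -
      have "\<bar>r + t\<bar> < 1"
        using that d r R by linarith
      moreover have "((\<lambda>t. r + t) has_real_derivative 1) (at t)"
        by (auto intro!: derivative_eq_intros)
      ultimately have "((\<lambda>t. W (r + t)) has_real_derivative 5/2 / (1 - (r + t)\<^sup>2) * 1) (at t)"
        by (intro DERIV_chain2[OF DW])
      then show ?thesis
        by (simp only: mult_1_right)
    qed
    show "((\<lambda>t. 5/2 / (1 - (r + t)\<^sup>2)) has_real_derivative 5 * r / (1 - r\<^sup>2)\<^sup>2) (at 0)"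
    proof -
      have "((\<lambda>t. 1 - (r + t)\<^sup>2) has_real_derivative - 2 * r) (at 0)"
        by (auto intro!: derivative_eq_intros)
      from DERIV_const_divide[OF this, of "5/2"] show ?thesis
        using \<open>r\<^sup>2 < 1\<close> by simp
    qed
    show "u (z + t *\<^sub>R e) - W (r + t) \<le> u z - W (r + 0)" if "\<bar>t\<bar> < d" for t
      using max[of "z + t *\<^sub>R e"] radial[of t] that d by (simp add: r_def)
    show "((\<lambda>t. W (sqrt (r\<^sup>2 + t\<^sup>2))) has_real_derivative
        5/2 / (1 - (sqrt (r\<^sup>2 + t\<^sup>2))\<^sup>2) / sqrt (r\<^sup>2 + t\<^sup>2) * t) (at t)" if "\<bar>t\<bar> < d" for t
    proof -
      have "sqrt (r\<^sup>2 + t\<^sup>2) < 1"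
        using sqrt_le[OF that] R by linarith
      then have "\<bar>sqrt (r\<^sup>2 + t\<^sup>2)\<bar> < 1"
        by simp
      moreover have "r\<^sup>2 + t\<^sup>2 > 0"
        using r by (simp add: add_pos_nonneg)
      then have "((\<lambda>t. sqrt (r\<^sup>2 + t\<^sup>2)) has_real_derivative t / sqrt (r\<^sup>2 + t\<^sup>2)) (at t)"
        by (auto intro!: derivative_eq_intros simp: field_simps)
      ultimately have "((\<lambda>t. W (sqrt (r\<^sup>2 + t\<^sup>2))) has_real_derivative
          5/2 / (1 - (sqrt (r\<^sup>2 + t\<^sup>2))\<^sup>2) * (t / sqrt (r\<^sup>2 + t\<^sup>2))) (at t)"
        by (intro DERIV_chain2[OF DW])
      then show ?thesis
        by (simp only: times_divide_eq_right times_divide_eq_left)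
    qed
    show "((\<lambda>t. 5/2 / (1 - (sqrt (r\<^sup>2 + t\<^sup>2))\<^sup>2) / sqrt (r\<^sup>2 + t\<^sup>2) * t) has_real_derivative
        5/2 / (1 - r\<^sup>2) / r) (at 0)"
    proof -
      have "isCont (\<lambda>t. 5/2 / (1 - (sqrt (r\<^sup>2 + t\<^sup>2))\<^sup>2) / sqrt (r\<^sup>2 + t\<^sup>2)) 0"
        using r \<open>r\<^sup>2 < 1\<close> by (intro continuous_intros) auto
      moreover have "5/2 / (1 - (sqrt (r\<^sup>2 + 0\<^sup>2))\<^sup>2) / sqrt (r\<^sup>2 + 0\<^sup>2) = 5/2 / (1 - r\<^sup>2) / r"
        using r by simp
      ultimately show ?thesis
        by (rule DERIV_cong[OF DERIV_mult_id_at_0])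
    qed
    show "u (z + t *\<^sub>R vector [- (e$2), e$1]) - W (sqrt (r\<^sup>2 + t\<^sup>2)) \<le> u z - W (sqrt (r\<^sup>2 + 0\<^sup>2))"
      if "\<bar>t\<bar> < d" for t
      using max[of "z + t *\<^sub>R vector [- (e$2), e$1]"] tangential[of t] sqrt_le[OF that] r
      by (simp add: r_def)
  qed
  moreover have "4/5 * \<bar>5/2 / v\<bar> ^ 3 = (5 * r / v\<^sup>2) * (5/2 / v / r)" if "v > 0" for v :: real
    using that r by (simp add: power2_eq_square power3_eq_cube)
  from this[of "1 - r\<^sup>2"] have "4/5 * \<bar>5/2 / (1 - (r + 0)\<^sup>2)\<bar> ^ 3 = (5 * r / (1 - r\<^sup>2)\<^sup>2) * (5/2 / (1 - r\<^sup>2) / r)"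
    using \<open>r\<^sup>2 < 1\<close> by simp
  ultimately show False
    by simp
qed

section \<open>The barrier on the lower part of the square\<close>

text \<open>Multiplying the barrier by a constant lowers its curvature; 75 is the factor that brings it below
  \<open>4/5\<close>.\<close>
lemma bound_on_bottom_side:
  assumes "r \<le> 1" and p: "\<bar>p\<bar> < r"
    and rect: "\<And>x y. \<bar>x\<bar> \<le> r \<Longrightarrow> -1 \<le> y \<Longrightarrow> y \<le> 0 \<Longrightarrow> vector [x, y] \<in> \<Omega>"
    and top: "\<And>x. \<bar>x\<bar> \<le> r \<Longrightarrow> u (vector [x, 0]) \<le> M"
  shows "u (vector [p, -1]) \<le> M + 75 / (r\<^sup>2 - p\<^sup>2)\<^sup>2 * (5/4)"
proof (rule ccontr)
  \<comment> \<open>The second factor decreases from 5/4 on the bottom, which gives the stated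
    bound, to 1/4 on the top. Being at least 1/4, it preserves the blow-up of the first factor at
    the lateral sides.\<close>
  define w :: "real \<Rightarrow> real \<Rightarrow> real" where "w x y = 75 / (r\<^sup>2 - x\<^sup>2)\<^sup>2 * (5/4 - sqrt (y + 1))" for x y
  assume "\<not> ?thesis"
  then have gt: "u (vector [p, -1]) - w p (-1) > M"
    by (simp add: w_def)
  have in_box: "z \<in> cbox (vector [-a, -1]) (vector [a, 0]) \<longleftrightarrow> \<bar>z$1\<bar> \<le> a \<and> -1 \<le> z$2 \<and> z$2 \<le> 0"
    for a and z :: "real^2"
    by (auto simp: mem_box_cart forall_2)
  have eta: "vector [z$1, z$2] = z" for z :: "real^2"
    by (simp add: vec_eq_iff forall_2)
  have box: "cbox (vector [-r, -1]) (vector [r, 0]) \<subseteq> \<Omega>"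
    using rect by (metis eta in_box subsetI)
  obtain B where B: "\<And>z. z \<in> cbox (vector [-r, -1]) (vector [r, 0]) \<Longrightarrow> u z \<le> B"
    using bounded_above_on_compact[OF compact_cbox box] by blast
  \<comment> \<open>On the walls \<open>\<bar>x\<bar> = r - \<delta>\<close> one has
    \<open>r\<^sup>2 - x\<^sup>2 \<le> 2 * \<delta>\<close>, so \<open>w\<close> is at least a
    multiple of \<open>1 / \<delta>\<^sup>2\<close> and hence at least \<open>B - M\<close>. The
    first term of the minimum keeps \<open>p\<close> between the walls.\<close>
  define \<delta> where "\<delta> = min (r - \<bar>p\<bar>) (1 / (\<bar>B - M\<bar> + 1))"
  define \<rho> where "\<rho> = r - \<delta>"
  have \<delta>: "\<delta> > 0" "\<delta> \<le> 1 / (\<bar>B - M\<bar> + 1)"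
    using p by (auto simp: \<delta>_def intro: divide_pos_pos)
  have \<rho>: "\<bar>p\<bar> \<le> \<rho>" "\<rho> < r"
    using p \<delta> by (auto simp: \<rho>_def \<delta>_def)
  have gap: "r\<^sup>2 - x\<^sup>2 > 0" if "\<bar>x\<bar> < r" for x
    using that by (simp add: abs_square_less_1 power2_strict_mono)
  have wall: "B - M \<le> 75 / (r\<^sup>2 - \<rho>\<^sup>2)\<^sup>2 * (1/4)"
  proof -
    have "r\<^sup>2 - \<rho>\<^sup>2 = \<delta> * (r + \<rho>)"
      by (simp add: \<rho>_def power2_eq_square algebra_simps)
    also have "\<dots> \<le> \<delta> * 2"
      using \<rho> \<open>r \<le> 1\<close> \<delta> by (intro mult_left_mono) auto
    finally have "(r\<^sup>2 - \<rho>\<^sup>2)\<^sup>2 \<le> (\<delta> * 2)\<^sup>2"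
      using gap[of \<rho>] \<rho> by (intro power_mono) auto
    then have "75 / (r\<^sup>2 - \<rho>\<^sup>2)\<^sup>2 \<ge> 75 / (\<delta> * 2)\<^sup>2"
      using gap[of \<rho>] \<rho> by (intro divide_left_mono) (auto intro!: mult_pos_pos simp: \<delta>)
    moreover have "\<bar>B - M\<bar> + 1 \<le> 1 / \<delta>"
      using \<delta> by (simp add: field_simps)
    moreover have "1 / \<delta> \<le> (1 / \<delta>)\<^sup>2"
      using \<open>\<bar>B - M\<bar> + 1 \<le> 1 / \<delta>\<close> by (intro self_le_power) auto
    moreover have "75 / (\<delta> * 2)\<^sup>2 = 75/4 * (1 / \<delta>)\<^sup>2"
      by (simp add: power2_eq_square)
    moreover have "B - M \<le> X * (1/4)"
      if "X \<ge> Y" "\<bar>B - M\<bar> + 1 \<le> q" "q \<le> Q" "Y = 75/4 * Q" for X Y q Q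
      using that by linarith
    ultimately show ?thesis
      by blast
  qed
  let ?K = "cbox (vector [-\<rho>, -1]) (vector [\<rho>, 0]) :: (real^2) set"
  have "?K \<subseteq> cbox (vector [-r, -1]) (vector [r, 0])"
    unfolding subset_iff in_box using \<rho> by auto
  note K = this subset_trans[OF this box]
  have "r\<^sup>2 - (z$1)\<^sup>2 > 0" if "z \<in> ?K" for z
    using that \<rho> by (intro gap) (auto simp: in_box)
  then have "continuous_on ?K (\<lambda>z. u z - w (z$1) (z$2))"
    unfolding w_def
    by (intro continuous_intros continuous_on_subset[OF continuous_on_u K(2)]) fastforce
  moreover have "vector [p, -1] \<in> ?K"
    using \<rho> by (simp add: in_box)
  ultimately obtain z where z: "z \<in> ?K"
      and max: "\<And>y. y \<in> ?K \<Longrightarrow> u y - w (y$1) (y$2) \<le> u z - w (z$1) (z$2)"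
    using continuous_attains_sup[OF compact_cbox, of "vector [-\<rho>, -1]" "vector [\<rho>, 0]"
      "\<lambda>z. u z - w (z$1) (z$2)"] by blast
  define a b where "a = z$1" and "b = z$2"
  have zab: "z = vector [a, b]"
    by (simp add: a_def b_def eta)
  have ab: "\<bar>a\<bar> \<le> \<rho>" "-1 \<le> b" "b \<le> 0"
    using z by (auto simp: in_box a_def b_def)
  have max': "u (vector [x, y]) - w x y \<le> u z - w a b" if "\<bar>x\<bar> \<le> \<rho>" "-1 \<le> y" "y \<le> 0" for x y
    using max[of "vector [x, y]"] that by (simp add: in_box a_def b_def)
  have z_gt: "u z - w a b > M"
    using max'[of p "-1"] gt \<rho> by simp
  have "z \<in> \<Omega>"
    using z K by blast
  define Z where "Z = r\<^sup>2 - a\<^sup>2"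
  have Z: "Z > 0"
    using gap[of a] ab \<rho> by (simp add: Z_def)
  have "b \<noteq> 0"
  proof
    assume "b = 0"
    then have "w a b \<ge> 0"
      by (simp add: w_def)
    then show False
      using z_gt top[of a] ab \<rho> by (simp add: zab \<open>b = 0\<close>)
  qed
  \<comment> \<open>Moving up by \<open>s\<^sup>2\<close> lowers \<open>w\<close> by a multiple of
    \<open>s\<close>, whereas \<open>u\<close> changes only by order \<open>s\<^sup>2\<close>
    because it is differentiable there; for small \<open>s\<close> the difference
    \<open>u - w\<close> would increase.\<close>
  moreover have "b \<noteq> -1"
  proof
    assume "b = -1"
    define c where "c = Du z \<bullet> vector [0, 1]"
    have "((\<lambda>t. u (z + t *\<^sub>R vector [0, 1])) has_real_derivative c) (at 0)"
      using directional_derivative[of z 0 "vector [0, 1]"] \<open>z \<in> \<Omega>\<close> by (simp add: c_def)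
    then obtain \<epsilon> where \<epsilon>: "\<epsilon> > 0"
      "\<And>t. t \<noteq> 0 \<Longrightarrow> \<bar>t\<bar> < \<epsilon> \<Longrightarrow> \<bar>(u (z + t *\<^sub>R vector [0, 1]) - u z) / t - c\<bar> < 1"
      unfolding DERIV_def LIM_eq by (auto dest: spec[of _ 1])
    \<comment> \<open>The last term makes the drop of \<open>w\<close> at least
      \<open>(\<bar>c\<bar> + 1) * s\<^sup>2\<close>, while the difference quotient of
      \<open>u\<close> stays above \<open>c - 1\<close>.\<close>
    define s where "s = Min {\<epsilon> / 2, 1, 75 / Z\<^sup>2 / (\<bar>c\<bar> + 1)}"
    have s: "0 < s" "s < \<epsilon>" "s \<le> 1" "s \<le> 75 / Z\<^sup>2 / (\<bar>c\<bar> + 1)"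
      using \<epsilon> Z unfolding s_def by auto
    have "s\<^sup>2 \<le> s"
      using s by (simp add: power2_eq_square mult_left_le)
    then have s2: "\<bar>s\<^sup>2\<bar> < \<epsilon>" "s\<^sup>2 \<noteq> 0" "s\<^sup>2 \<le> 1"
      using s by auto
    have "u (vector [a, s\<^sup>2 - 1]) - w a (s\<^sup>2 - 1) \<le> u z - w a b"
      using s2 ab by (intro max') auto
    moreover have "w a (s\<^sup>2 - 1) = w a b - 75 / Z\<^sup>2 * s"
      using s Z by (simp add: w_def \<open>b = -1\<close> flip: Z_def) (simp add: field_simps)
    moreover have "vector [a, s\<^sup>2 - 1] = z + s\<^sup>2 *\<^sub>R vector [0, 1]"
      by (simp add: zab vec_eq_iff forall_2 \<open>b = -1\<close>)
    ultimately have "u (z + s\<^sup>2 *\<^sub>R vector [0, 1]) - u z \<le> - (75 / Z\<^sup>2 * s)"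
      by simp
    also have "\<dots> \<le> - ((\<bar>c\<bar> + 1) * s * s)"
    proof -
      have "(\<bar>c\<bar> + 1) * s \<le> 75 / Z\<^sup>2"
        using s(4) pos_le_divide_eq[of "\<bar>c\<bar> + 1" s "75 / Z\<^sup>2"]
        by (simp only: mult.commute)
      then show ?thesis
        using s by (simp only: neg_le_iff_le mult_right_mono less_imp_le)
    qed
    also have "\<dots> = - (\<bar>c\<bar> + 1) * s\<^sup>2"
      by (simp add: power2_eq_square algebra_simps)
    finally have "(u (z + s\<^sup>2 *\<^sub>R vector [0, 1]) - u z) / s\<^sup>2 \<le> - (\<bar>c\<bar> + 1)"
      using s by (subst pos_divide_le_eq) simp_all
    then show False
      using \<epsilon>(2)[OF s2(2,1)] by linarith
  qed
  moreover have "\<bar>a\<bar> \<noteq> \<rho>"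
  proof
    assume "\<bar>a\<bar> = \<rho>"
    then have "Z = r\<^sup>2 - \<rho>\<^sup>2"
      by (auto simp: Z_def)
    have "75 / Z\<^sup>2 * (1/4) \<le> w a b"
      unfolding w_def Z_def[symmetric] using ab by (intro mult_left_mono) auto
    moreover have "u z \<le> B"
      using B z K by blast
    ultimately show False
      using z_gt wall \<open>Z = r\<^sup>2 - \<rho>\<^sup>2\<close> by simp
  qed
  ultimately have int: "\<bar>a\<bar> < \<rho>" "-1 < b" "b < 0"
    using ab by auto
  define d where "d = Min {\<rho> - \<bar>a\<bar>, b + 1, - b}"
  have d: "d > 0" "d \<le> \<rho> - \<bar>a\<bar>" "d \<le> b + 1" "d \<le> - b"
    using int by (auto simp: d_def)
  define \<sigma> where "\<sigma> = sqrt (b + 1)"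
  have \<sigma>: "0 < \<sigma>" "\<sigma> \<le> 1"
    using int by (auto simp: \<sigma>_def)
  let ?C = "75 * (5/4 - \<sigma>)"
  \<comment> \<open>Here \<open>e\<close> is vertical, so the slope kept is that in
    \<open>y\<close>. Its rotation is \<open>(-1, 0)\<close>, whence \<open>a - t\<close> in the
    horizontal restriction.\<close>
  have "4/5 * \<bar>- (75 / Z\<^sup>2) / (2 * sqrt (b + 0 + 1))\<bar> ^ 3
      < 75 / Z\<^sup>2 / (4 * \<sigma> ^ 3) * (?C * (4 * r\<^sup>2 + 20 * a\<^sup>2) / Z ^ 4)"
  proof (rule touching_from_above[where x = z and e = "vector [0, 1]" and d = d
      and \<phi> = "\<lambda>t. w a (b + t)" and \<phi>' = "\<lambda>t. - (75 / Z\<^sup>2) / (2 * sqrt (b + t + 1))"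
      and \<psi> = "\<lambda>t. w (a - t) b" and \<psi>' = "\<lambda>t. - 4 * ?C * (a - t) / (r\<^sup>2 - (a - t)\<^sup>2) ^ 3"])
    show "z \<in> \<Omega>" "d > 0"
      by fact+
    show "((vector [0, 1] :: real^2)$1)\<^sup>2 + ((vector [0, 1] :: real^2)$2)\<^sup>2 = 1"
      by simp
    show "((\<lambda>t. w a (b + t)) has_real_derivative - (75 / Z\<^sup>2) / (2 * sqrt (b + t + 1))) (at t)"
      if "\<bar>t\<bar> < d" for t
      unfolding w_def Z_def[symmetric] using that d Z
      by (auto intro!: derivative_eq_intros simp: field_simps)
    show "((\<lambda>t. - (75 / Z\<^sup>2) / (2 * sqrt (b + t + 1))) has_real_derivative 75 / Z\<^sup>2 / (4 * \<sigma> ^ 3)) (at 0)"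
    proof -
      have "((\<lambda>t. 2 * sqrt (b + t + 1)) has_real_derivative 1 / \<sigma>) (at 0)"
        using int by (auto intro!: derivative_eq_intros simp: \<sigma>_def inverse_eq_divide)
      then have "((\<lambda>t. - (75 / Z\<^sup>2) / (2 * sqrt (b + t + 1))) has_real_derivative
          - (- (75 / Z\<^sup>2)) * (1 / \<sigma>) / (2 * sqrt (b + 0 + 1))\<^sup>2) (at 0)"
        by (rule DERIV_const_divide) (use int in simp)
      moreover have "- (- (75 / Z\<^sup>2)) * (1 / \<sigma>) / (2 * sqrt (b + 0 + 1))\<^sup>2 = 75 / Z\<^sup>2 / (4 * \<sigma> ^ 3)"
        by (simp add: power2_eq_square power3_eq_cube flip: \<sigma>_def)
      ultimately show ?thesis
        by (rule DERIV_cong)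
    qed
    show "u (z + t *\<^sub>R vector [0, 1]) - w a (b + t) \<le> u z - w a (b + 0)" if "\<bar>t\<bar> < d" for t
    proof -
      have "z + t *\<^sub>R vector [0, 1] = vector [a, b + t]"
        by (simp add: zab vec_eq_iff forall_2)
      then show ?thesis
        using max'[of a "b + t"] that d ab by simp
    qed
    show "((\<lambda>t. w (a - t) b) has_real_derivative - 4 * ?C * (a - t) / (r\<^sup>2 - (a - t)\<^sup>2) ^ 3) (at t)"
      if "\<bar>t\<bar> < d" for t
    proof -
      have "r\<^sup>2 - (a - t)\<^sup>2 > 0"
        using gap[of "a - t"] that d \<rho> by linarith
      moreover have "((\<lambda>t. (r\<^sup>2 - (a - t)\<^sup>2)\<^sup>2) has_real_derivative 4 * (a - t) * (r\<^sup>2 - (a - t)\<^sup>2)) (at t)"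
        by (auto intro!: derivative_eq_intros)
      ultimately have "((\<lambda>t. ?C / (r\<^sup>2 - (a - t)\<^sup>2)\<^sup>2) has_real_derivative
          - ?C * (4 * (a - t) * (r\<^sup>2 - (a - t)\<^sup>2)) / ((r\<^sup>2 - (a - t)\<^sup>2)\<^sup>2)\<^sup>2) (at t)"
        by (intro DERIV_const_divide) auto
      moreover have "- C * (4 * (a - t) * X) / (X\<^sup>2)\<^sup>2 = - 4 * C * (a - t) / X ^ 3"
        if "X > 0" for C X :: real
        using that by (simp add: divide_simps power2_eq_square power3_eq_cube)
      note this[OF \<open>r\<^sup>2 - (a - t)\<^sup>2 > 0\<close>, of ?C]
      moreover have "(\<lambda>t. w (a - t) b) = (\<lambda>t. ?C / (r\<^sup>2 - (a - t)\<^sup>2)\<^sup>2)"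
        by (simp add: w_def \<sigma>_def fun_eq_iff)
      ultimately show ?thesis
        by (simp only:)
    qed
    show "((\<lambda>t. - 4 * ?C * (a - t) / (r\<^sup>2 - (a - t)\<^sup>2) ^ 3) has_real_derivative
        ?C * (4 * r\<^sup>2 + 20 * a\<^sup>2) / Z ^ 4) (at 0)"
    proof -
      have "((\<lambda>t. - 4 * ?C * (a - t)) has_real_derivative 4 * ?C) (at 0)"
        by (auto intro!: derivative_eq_intros)
      moreover have "((\<lambda>t. (r\<^sup>2 - (a - t)\<^sup>2) ^ 3) has_real_derivative 3 * Z\<^sup>2 * (2 * a)) (at 0)"
        by (auto intro!: derivative_eq_intros simp: Z_def)
      ultimately have "((\<lambda>t. - 4 * ?C * (a - t) / (r\<^sup>2 - (a - t)\<^sup>2) ^ 3) has_real_derivative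
          (4 * ?C * (r\<^sup>2 - (a - 0)\<^sup>2) ^ 3 - - 4 * ?C * (a - 0) * (3 * Z\<^sup>2 * (2 * a)))
            / ((r\<^sup>2 - (a - 0)\<^sup>2) ^ 3 * (r\<^sup>2 - (a - 0)\<^sup>2) ^ 3)) (at 0)"
        by (rule DERIV_divide) (use Z in \<open>simp add: Z_def\<close>)
      moreover have "(4 * C * Z ^ 3 - - 4 * C * a * (3 * Z\<^sup>2 * (2 * a))) / (Z ^ 3 * Z ^ 3)
          = C * (4 * Z + 24 * a\<^sup>2) / Z ^ 4" for C
        using Z by (simp add: divide_simps) (simp add: eval_nat_numeral algebra_simps)
      moreover have "4 * Z + 24 * a\<^sup>2 = 4 * r\<^sup>2 + 20 * a\<^sup>2"
        by (simp add: Z_def)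
      ultimately show ?thesis
        by (simp only: diff_0_right flip: Z_def)
    qed
    show "u (z + t *\<^sub>R vector [- ((vector [0, 1] :: real^2)$2), (vector [0, 1] :: real^2)$1]) - w (a - t) b
        \<le> u z - w (a - 0) b" if "\<bar>t\<bar> < d" for t
    proof -
      have "z + t *\<^sub>R vector [- ((vector [0, 1] :: real^2)$2), (vector [0, 1] :: real^2)$1] = vector [a - t, b]"
        by (simp add: zab vec_eq_iff forall_2)
      then show ?thesis
        using max'[of "a - t" b] that d ab by simp
    qed
  qed
  \<comment> \<open>With \<open>K\<close> in place of 75, the comparison of both sides reduces to
    \<open>2/5 * K^2 \<ge> K * (5/4) * 24\<close>, that is \<open>K \<ge> 75\<close>. The 24 bounds
    \<open>4 * r\<^sup>2 + 20 * a\<^sup>2\<close>, and 5/4 bounds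
    \<open>5/4 - \<sigma>\<close>.\<close>
  moreover have "4/5 * \<bar>- (75 / Z\<^sup>2) / (2 * sqrt (b + 0 + 1))\<bar> ^ 3
      = 75 / Z\<^sup>2 / (4 * \<sigma> ^ 3) * ((75 * (5/4)) * 24 / Z ^ 4)"
  proof -
    have "\<bar>- (75 / Z\<^sup>2) / (2 * sqrt (b + 0 + 1))\<bar> = 75 / Z\<^sup>2 / (2 * \<sigma>)"
      using \<sigma> by (simp add: abs_divide abs_mult flip: \<sigma>_def)
    then show ?thesis
      using Z \<sigma> by (simp add: power_divide power_mult_distrib eval_nat_numeral)
  qed
  moreover have "75 / Z\<^sup>2 / (4 * \<sigma> ^ 3) * (?C * (4 * r\<^sup>2 + 20 * a\<^sup>2) / Z ^ 4)
      \<le> 75 / Z\<^sup>2 / (4 * \<sigma> ^ 3) * ((75 * (5/4)) * 24 / Z ^ 4)"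
  proof -
    have "r\<^sup>2 \<le> 1" "a\<^sup>2 \<le> 1"
      using \<open>r \<le> 1\<close> int \<rho> by (auto simp: abs_square_le_1)
    then have "?C * (4 * r\<^sup>2 + 20 * a\<^sup>2) \<le> (75 * (5/4)) * 24"
      using \<sigma> by (intro mult_mono) auto
    then show ?thesis
      using Z \<sigma> by (intro mult_left_mono divide_right_mono) auto
  qed
  ultimately show False
    by linarith
qed

end

section \<open>Area bound and choice of the constants\<close>

theorem theorem5p2:
  fixes \<Omega> :: "(real^2) set" and u :: "real^2 \<Rightarrow> real"
    and Du :: "real^2 \<Rightarrow> real^2" and D2u :: "real^2 \<Rightarrow> real^2 \<Rightarrow> real^2"
  assumes "open \<Omega>" and "strictly_convex_set \<Omega>" and "smooth_boundary \<Omega>"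
    and "axially_symmetric \<Omega>"
    and "cbox (vector [-1, -1]) (vector [1, 1]) \<subseteq> \<Omega>"
    and "\<Omega> \<subseteq> cbox (vector [-4/3, -4/3]) (vector [4/3, 4/3])"
    and "convex_on \<Omega> u"
    and "\<And>x. x \<in> \<Omega> \<Longrightarrow> (u has_derivative (\<lambda>h. Du x \<bullet> h)) (at x)"
    and "\<And>x. x \<in> \<Omega> \<Longrightarrow> (Du has_derivative D2u x) (at x)"
    and "continuous_on \<Omega> (\<lambda>x. matrix (D2u x))"
    and "\<And>x. x \<in> \<Omega> \<Longrightarrow>
           det (matrix (D2u x)) / (1 + (norm (Du x))\<^sup>2) powr (3/2) = 2 * pi / measure lebesgue \<Omega>"
    and "\<And>z. z \<in> frontier \<Omega> \<Longrightarrow> filterlim (\<lambda>x. norm (Du x)) at_top (at z within \<Omega>)"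
    and "0 < \<alpha>" and "\<alpha> < 1/6"
  shows "u (vector [1 - 6 * \<alpha>, -1]) - u (vector [0, 0]) \<le> 6 * (1 + 1 / \<alpha>\<^sup>2)"
proof -
  have content: "measure lebesgue (cbox (vector [-c, -c]) (vector [c, c] :: real^2)) = (2 * c)\<^sup>2"
    if "c \<ge> 0" for c :: real
  proof -
    have "cbox (vector [-c, -c]) (vector [c, c] :: real^2) \<noteq> {}"
      using that by (simp add: interval_ne_empty_cart forall_2)
    then show ?thesis
      by (simp add: measure_completion content_cbox_cart UNIV_2 power2_eq_square)
  qed
  have lmeas: "\<Omega> \<in> lmeasurable"
    using assms(1,6) by (intro lmeasurable_open bounded_subset[OF bounded_cbox])
  have area: "measure lebesgue \<Omega> \<ge> 4" "measure lebesgue \<Omega> \<le> 64/9"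
    using measure_mono_fmeasurable[OF assms(5) _ lmeas]
      measure_mono_fmeasurable[OF assms(6) _ lmeasurable_cbox] lmeas content[of 1] content[of "4/3"]
    by (auto simp: power2_eq_square fmeasurableD)
  \<comment> \<open>With 3 in place of \<open>pi\<close> the quotient is 27/32.\<close>
  have "4/5 \<le> 2 * 3 / (64/9 :: real)"
    by simp
  also have "\<dots> \<le> 2 * pi / measure lebesgue \<Omega>"
    using area pi_gt3 by (intro frac_le) auto
  finally have K: "4/5 \<le> 2 * pi / measure lebesgue \<Omega>" .
  interpret curvature_bound \<Omega> u Du D2u
  proof
    fix x assume x: "x \<in> \<Omega>"
    have "1 + (norm (Du x))\<^sup>2 > 0"
      by (simp add: add_pos_nonneg)
    then have "(1 + (norm (Du x))\<^sup>2) powr (3/2) > 0"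
      by simp
    moreover have "4/5 \<le> det (matrix (D2u x)) / (1 + (norm (Du x))\<^sup>2) powr (3/2)"
      using K by (simp only: assms(11)[OF x])
    ultimately show "4/5 * (1 + (norm (Du x))\<^sup>2) powr (3/2) \<le> det (matrix (D2u x))"
      by (simp only: pos_le_divide_eq)
  qed (fact assms(1,7-10))+

  have in_\<Omega>: "z \<in> \<Omega>" if "\<bar>z$1\<bar> \<le> 1" "\<bar>z$2\<bar> \<le> 1" for z
    using that by (intro subsetD[OF assms(5)]) (auto simp: mem_box_cart forall_2)
  have zero: "vector [0, 0] = (0 :: real^2)"
    by (simp add: vec_eq_iff forall_2)
  have disc: "cball 0 1 \<subseteq> \<Omega>"
  proof
    fix z :: "real^2" assume "z \<in> cball 0 1"
    then show "z \<in> \<Omega>"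
      using component_le_norm_cart[of z 1] component_le_norm_cart[of z 2] by (intro in_\<Omega>) auto
  qed
  \<comment> \<open>A compromise: the logarithmic bound on the top side degenerates as
    \<open>r\<close> tends to 1, the second barrier as \<open>r\<close> decreases to
    \<open>1 - 6 * \<alpha>\<close>.\<close>
  define r where "r = 1 - 3/4 * \<alpha>"
  define M where "M = u 0 + 20 / (6 * \<alpha>)"
  have r: "0 < r" "r < 1"
    using \<open>0 < \<alpha>\<close> \<open>\<alpha> < 1/6\<close> by (auto simp: r_def)
  have top: "u (vector [x, 0]) \<le> M" if "\<bar>x\<bar> \<le> r" for x
  proof -
    have n: "norm (vector [x, 0] :: real^2) = \<bar>x\<bar>"
      by (simp add: norm_vec_def L2_set_def sum_2)
    have "u (vector [x, 0]) - u 0 \<le> 5/4 * ln ((1 + \<bar>x\<bar>) / (1 - \<bar>x\<bar>))"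
      using bound_in_unit_disc[OF disc, of "vector [x, 0]"] that r unfolding n by simp
    \<comment> \<open>The crude bound of \<open>ln q\<close> by \<open>q - 1\<close> gives order
      \<open>1 / \<alpha>\<close>, which the \<open>1 / \<alpha>\<^sup>2\<close> of the claim
      absorbs.\<close>
    also have "\<dots> \<le> 5/4 * ((1 + \<bar>x\<bar>) / (1 - \<bar>x\<bar>) - 1)"
      using that r by (intro mult_left_mono ln_le_minus_one divide_pos_pos) auto
    also have "\<dots> \<le> 5/4 * (2 / (1 - r))"
    proof -
      have "(1 + \<bar>x\<bar>) / (1 - \<bar>x\<bar>) - 1 = 2 * \<bar>x\<bar> / (1 - \<bar>x\<bar>)"
        using that r by (simp add: field_simps)
      also have "\<dots> \<le> 2 / (1 - r)"
        using that r by (intro frac_le) auto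
      finally show ?thesis
        by (rule mult_left_mono) simp
    qed
    also have "\<dots> = 20 / (6 * \<alpha>)"
      by (simp add: r_def)
    finally show ?thesis
      by (simp add: M_def)
  qed
  define p where "p = 1 - 6 * \<alpha>"
  have "u (vector [p, -1]) \<le> M + 75 / (r\<^sup>2 - p\<^sup>2)\<^sup>2 * (5/4)"
    using \<open>0 < \<alpha>\<close> \<open>\<alpha> < 1/6\<close> r top
    by (intro bound_on_bottom_side in_\<Omega>) (auto simp: p_def r_def)
  moreover have "75 / (r\<^sup>2 - p\<^sup>2)\<^sup>2 * (5/4) \<le> 5 / \<alpha>\<^sup>2"
  proof -
    \<comment> \<open>The right-hand side is \<open>(r - p) * (r + p)\<close>; the left-hand side is
      its lower bound from \<open>2 - 27/4 * \<alpha> \<ge> 7/8\<close>, valid for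
      \<open>\<alpha> < 1/6\<close>.\<close>
    have "\<alpha> * (49/64 * 6) \<le> \<alpha> * (21/4 * (2 - 27/4 * \<alpha>))"
      using \<open>0 < \<alpha>\<close> \<open>\<alpha> < 1/6\<close> by (intro mult_left_mono) auto
    then have "49/64 * (6 * \<alpha>) \<le> \<alpha> * (21/4 * (2 - 27/4 * \<alpha>))"
      by simp
    also have "\<dots> = r\<^sup>2 - p\<^sup>2"
      by (simp add: r_def p_def power2_eq_square algebra_simps)
    finally have "(49/64 * (6 * \<alpha>))\<^sup>2 \<le> (r\<^sup>2 - p\<^sup>2)\<^sup>2"
      using \<open>0 < \<alpha>\<close> by (intro power_mono) auto
    then have "75 / (r\<^sup>2 - p\<^sup>2)\<^sup>2 \<le> 75 / (49/64 * (6 * \<alpha>))\<^sup>2"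
      using \<open>0 < \<alpha>\<close> by (intro frac_le) auto
    also have "\<dots> \<le> 4 / \<alpha>\<^sup>2"
      using \<open>0 < \<alpha>\<close> by (simp add: power_mult_distrib divide_simps power2_eq_square)
    finally show ?thesis
      by simp
  qed
  \<comment> \<open>One factor \<open>\<alpha>\<close> is traded for 1/6; the total 5 + 5/9 remains
    below 6.\<close>
  moreover have "20 / (6 * \<alpha>) \<le> 20/36 / \<alpha>\<^sup>2"
    using \<open>0 < \<alpha>\<close> \<open>\<alpha> < 1/6\<close> by (simp add: field_simps power2_eq_square)
  moreover have "5 / \<alpha>\<^sup>2 + 20/36 / \<alpha>\<^sup>2 \<le> 6 * (1 + 1 / \<alpha>\<^sup>2)"
    using \<open>0 < \<alpha>\<close> by (simp add: field_simps)
  ultimately show ?thesis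
    by (simp add: M_def p_def zero)
qed

end
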